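(* Let $X,Y,Z\in\mathcal{P}(n)$ and let $L=\min(s(Y,X),s(Y,Z))$. Let $g_X,g_Z\in SL(n,\mathbb{R})$ be elements (which exist) that map $Y$ to the identity and map $X$ and $Z$ into $F_{mod}$, respectively, i.e. $g_X.Y=g_Z.Y=I$, $g_X.X\in F_{mod}$, $g_Z.Z\in F_{mod}$. Let $\theta$ be the maximum angle between the corresponding column vectors of $Y^{1/2}g_X$ and $Y^{1/2}g_Z\in SO(n)$. Suppose that there is a number $t\in(0,1)$ and a subset $\mathcal{I}\subset\{1,\dots,n\}$ such that $g_X.X\in\Delta^{\mathcal{I}}_t$, $g_Z.Z\in\Delta^{\mathcal{I}^{\mathsf c}}_t$, and $$\frac{1+\sqrt{n-2}\,\sin\theta}{\cos\theta-\sqrt{n-2}\,\sin\theta}\le\sqrt{t}\cdot\left(\frac{L-1}{n-1}\right)^{t/2}.$$ Then the bisectors $Bis(X,Y)$ and $Bis(Y,Z)$ in $\mathcal{P}(n)$ are disjoint.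
   Context: $\mathcal{P}(n)=\{X\in Sym_n(\mathbb{R}):\det X=1,\ X>0\}$ (real symmetric positive definite), with the action of $SL(n,\mathbb{R})$ by $g.X=g^TXg$. Selberg's invariant is $s(X,Y)=\mathrm{tr}(X^{-1}Y)$, and the Selberg bisector is $Bis(X,Y)=\{Z\in\mathcal{P}(n): s(X,Z)=s(Y,Z)\}$. The model flat is $F_{mod}=\{\mathrm{diag}(x_1,\dots,x_n): x_i>0,\ \prod x_i=1\}$. It contains $2^n-2$ chambers, one for each non-empty proper subset $\mathcal{I}$ of $\{1,\dots,n\}$: $$\Delta^{\mathcal I}=\{\mathrm{diag}(x_i)\in F_{mod}: 0<x_i<1\ \forall i\in\mathcal I;\ x_i>1\ \forall i\notin\mathcal I\}.$$ For $t\in(0,1)$, $$\Delta^{\mathcal I}_t=\left\{\mathrm{diag}(x_i)\in\Delta^{\mathcal I}:\ \frac{\min_i|\log x_i|}{\max_i|\log x_i|}\ge t\right\}.$$ $\mathcal{I}^{\mathsf c}$ is the complement of $\mathcal I$ in $\{1,\dots,n\}$. $Y^{1/2}$ is the positive definite square root of $Y$.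
   Formalization: The formal theorem assumes n ≥ 3 (for n = 2 the claim is false) and that the denominator cos θ − √(n−2) sin θ is positive (otherwise the inequality is vacuous or undefined and the claim fails); the aside that g_X, g_Z exist is not proved. *)

theory Defs
  imports "HOL-Analysis.Analysis"
begin

definition posdef :: "real^'n^'n \<Rightarrow> bool" where
  "posdef A \<longleftrightarrow> transpose A = A \<and> (\<forall>v. v \<noteq> 0 \<longrightarrow> 0 < v \<bullet> (A *v v))"

definition PD :: "(real^'n^'n) set" where
  "PD = {X. posdef X \<and> det X = 1}"

definition SL :: "(real^'n^'n) set" where
  "SL = {g. det g = 1}"

definition act :: "real^'n^'n \<Rightarrow> real^'n^'n \<Rightarrow> real^'n^'n" where
  "act g X = transpose g ** X ** g"

definition selberg :: "real^'n^'n \<Rightarrow> real^'n^'n \<Rightarrow> real" where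
  "selberg X Y = trace (matrix_inv X ** Y)"

definition Bis :: "real^'n^'n \<Rightarrow> real^'n^'n \<Rightarrow> (real^'n^'n) set" where
  "Bis X Y = {Z \<in> PD. selberg X Z = selberg Y Z}"

definition diag :: "real^'n \<Rightarrow> real^'n^'n" where
  "diag x = (\<chi> i j. if i = j then x $ i else 0)"

definition F_mod :: "(real^'n^'n) set" where
  "F_mod = {diag x | x. (\<forall>i. 0 < x $ i) \<and> (\<Prod>i\<in>UNIV. x $ i) = 1}"

text \<open>For \<open>I = {}\<close> and \<open>I = UNIV\<close> the following set is empty, since the entries
  multiply to \<open>1\<close>; only non-empty proper subsets \<open>I\<close> of the index set give chambers.\<close>

definition chamber :: "'n set \<Rightarrow> (real^'n^'n) set" where
  "chamber I = {diag x | x. diag x \<in> F_mod \<and>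
     (\<forall>i\<in>I. 0 < x $ i \<and> x $ i < 1) \<and> (\<forall>i. i \<notin> I \<longrightarrow> 1 < x $ i)}"

definition chamber_t :: "'n set \<Rightarrow> real \<Rightarrow> (real^'n^'n) set" where
  "chamber_t I t = {diag x | x. diag x \<in> chamber I \<and>
     Min (range (\<lambda>i. \<bar>ln (x $ i)\<bar>)) / Max (range (\<lambda>i. \<bar>ln (x $ i)\<bar>)) \<ge> t}"

definition vangle :: "real^'n \<Rightarrow> real^'n \<Rightarrow> real" where
  "vangle u v = arccos (u \<bullet> v / (norm u * norm v))"

definition max_column_angle :: "real^'n^'n \<Rightarrow> real^'n^'n \<Rightarrow> real" where
  "max_column_angle A B = Max (range (\<lambda>i. vangle (column i A) (column i B)))"

definition posdef_sqrt :: "real^'n^'n \<Rightarrow> real^'n^'n" where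
  "posdef_sqrt Y = (THE S. posdef S \<and> S ** S = Y)"

text \<open>The spectral theorem for real symmetric matrices, used to show that
  \<open>posdef_sqrt\<close> is well defined.\<close>

lemma symmetric_inner:
  fixes A :: "real^'n^'n"
  assumes "transpose A = A"
  shows "x \<bullet> (A *v y) = (A *v x) \<bullet> y"
  using assms by (metis dot_lmul_matrix vector_transpose_matrix)

lemma symmetric_eigenvector_in_subspace:
  fixes A :: "real^'n^'n"
  assumes sym: "transpose A = A" and W: "subspace W" and inv: "\<And>w. w \<in> W \<Longrightarrow> A *v w \<in> W"
    and ne: "w0 \<in> W" "w0 \<noteq> 0"
  obtains u where "u \<in> W" "norm u = 1" "A *v u = (u \<bullet> (A *v u)) *\<^sub>R u"
proof -
  let ?K = "W \<inter> sphere 0 1"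
  have "compact ?K"
    using closed_subspace[OF W] by (simp add: closed_Int_compact)
  moreover have "w0 /\<^sub>R norm w0 \<in> ?K"
    using ne W by (simp add: subspace_scale)
  moreover have "continuous_on ?K (\<lambda>x. x \<bullet> (A *v x))"
    by (intro continuous_intros matrix_vector_mult_linear_continuous_on)
  ultimately obtain u where u: "u \<in> ?K" and max: "\<And>x. x \<in> ?K \<Longrightarrow> x \<bullet> (A *v x) \<le> u \<bullet> (A *v u)"
    using continuous_attains_sup[of ?K "\<lambda>x. x \<bullet> (A *v x)"] by blast
  define l where "l = u \<bullet> (A *v u)"
  have uW: "u \<in> W" and un: "norm u = 1" and uu: "u \<bullet> u = 1" using u by (auto simp: norm_eq_1)
  have le: "x \<bullet> (A *v x) \<le> l * (x \<bullet> x)" if "x \<in> W" for x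
  proof (cases "x = 0")
    case False
    have "x /\<^sub>R norm x \<in> ?K" using False that W by (simp add: subspace_scale)
    from max[OF this] have "(x \<bullet> (A *v x)) / (norm x)\<^sup>2 \<le> l"
      by (simp add: l_def matrix_vector_mult_scaleR power2_eq_square divide_inverse mult_ac)
    then show ?thesis using False by (simp add: divide_le_eq power2_norm_eq_inner)
  qed simp
  define w where "w = A *v u - l *\<^sub>R u"
  have wW: "w \<in> W" using inv uW W by (simp add: w_def subspace_diff subspace_scale)
  have uw: "u \<bullet> w = 0" by (simp add: w_def inner_diff_right l_def[symmetric] uu)
  have uAw: "u \<bullet> (A *v w) = w \<bullet> w"
  proof -
    have "u \<bullet> (A *v w) = (w + l *\<^sub>R u) \<bullet> w"
      by (simp add: symmetric_inner[OF sym] w_def)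
    then show ?thesis using uw by (simp add: inner_add_left)
  qed
  have wAu: "w \<bullet> (A *v u) = w \<bullet> w"
    using uAw symmetric_inner[OF sym] by (metis inner_commute)
  have q: "2 * e * (w \<bullet> w) \<le> e\<^sup>2 * (l * (w \<bullet> w) - w \<bullet> (A *v w))" for e
  proof -
    have "u + e *\<^sub>R w \<in> W" using uW wW W by (simp add: subspace_add subspace_scale)
    from le[OF this] show ?thesis
      using uw uu uAw wAu
      by (simp add: matrix_vector_right_distrib matrix_vector_mult_scaleR inner_add_left
          inner_add_right l_def[symmetric] inner_commute[of w u] power2_eq_square algebra_simps)
  qed
  have "w \<bullet> w = 0"
  proof (rule ccontr)
    assume "w \<bullet> w \<noteq> 0"
    then have p: "w \<bullet> w > 0" by (simp add: inner_gt_zero_iff)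
    define c where "c = \<bar>l * (w \<bullet> w) - w \<bullet> (A *v w)\<bar> + 1"
    have c: "c > 0" "l * (w \<bullet> w) - w \<bullet> (A *v w) \<le> c" by (auto simp: c_def)
    define e where "e = (w \<bullet> w) / c"
    have "2 * e * (w \<bullet> w) \<le> e\<^sup>2 * c"
      using q[of e] mult_left_mono[OF c(2), of "e\<^sup>2"] by simp
    moreover have "e\<^sup>2 * c = e * (w \<bullet> w)" using c(1) by (simp add: e_def power2_eq_square)
    moreover have "e * (w \<bullet> w) > 0" using p c(1) by (simp add: e_def)
    ultimately show False by simp
  qed
  then have "A *v u = l *\<^sub>R u" by (simp add: w_def)
  with that uW un show thesis by (auto simp: l_def)
qed

lemma symmetric_spectral:
  fixes A :: "real^'n^'n"
  assumes sym: "transpose A = A"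
  obtains B where "finite B" "span B = UNIV" "pairwise orthogonal B"
    "\<And>b. b \<in> B \<Longrightarrow> norm b = 1" "\<And>b. b \<in> B \<Longrightarrow> A *v b = (b \<bullet> (A *v b)) *\<^sub>R b"
proof -
  define P where "P B \<longleftrightarrow> finite B \<and> pairwise orthogonal B \<and> 0 \<notin> B \<and>
    (\<forall>b\<in>B. norm b = 1 \<and> A *v b = (b \<bullet> (A *v b)) *\<^sub>R b)" for B
  have ex: "\<exists>B. P B \<and> card B = k" if "k \<le> DIM(real^'n)" for k
    using that
  proof (induction k)
    case 0
    then show ?case by (intro exI[of _ "{}"]) (simp add: P_def)
  next
    case (Suc k)
    then obtain B where B: "P B" "card B = k" by auto
    have "dim B < DIM(real^'n)" using B Suc.prems dim_le_card'[of B] by (simp add: P_def)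
    then obtain w0 where w0: "w0 \<noteq> 0" "\<And>y. y \<in> span B \<Longrightarrow> orthogonal w0 y"
      using orthogonal_to_subspace_exists[of B] by blast
    define W where "W = {w. \<forall>b\<in>B. b \<bullet> w = 0}"
    have sW: "subspace W" by (auto simp: W_def subspace_def inner_add_right)
    have inv: "A *v w \<in> W" if "w \<in> W" for w
      unfolding W_def
    proof (intro CollectI ballI)
      fix b assume b: "b \<in> B"
      then have "A *v b = (b \<bullet> (A *v b)) *\<^sub>R b" using B by (auto simp: P_def)
      then have "b \<bullet> (A *v w) = (b \<bullet> (A *v b)) * (b \<bullet> w)"
        using symmetric_inner[OF sym, of b w] by (metis inner_scaleR_left)
      then show "b \<bullet> (A *v w) = 0" using b that by (simp add: W_def)
    qed
    have w0W: "w0 \<in> W"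
      using w0(2) by (auto simp: W_def orthogonal_def inner_commute span_base)
    obtain u where u: "u \<in> W" "norm u = 1" "A *v u = (u \<bullet> (A *v u)) *\<^sub>R u"
      using symmetric_eigenvector_in_subspace[OF sym sW inv w0W w0(1)] by blast
    have nB: "u \<notin> B" using u by (auto simp: W_def)
    have "P (insert u B)" using B u nB
      by (auto simp: P_def W_def pairwise_insert orthogonal_def inner_commute)
    moreover have "card (insert u B) = Suc k" using B nB by (simp add: P_def)
    ultimately show ?case by blast
  qed
  obtain B where B: "P B" "card B = DIM(real^'n)" using ex by blast
  have "independent B" using B by (simp add: P_def pairwise_orthogonal_independent)
  then have "span B = UNIV"
    using B card_ge_dim_independent[of B UNIV] by (auto simp: dim_UNIV)
  then show thesis using that B by (auto simp: P_def)
qed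

lemma posdef_sqrt_exists:
  fixes Y :: "real^'n^'n"
  assumes "posdef Y"
  shows "\<exists>S. posdef S \<and> S ** S = Y"
proof -
  have sym: "transpose Y = Y" using assms by (simp add: posdef_def)
  obtain B where B: "finite B" "span B = UNIV" "pairwise orthogonal B"
    "\<And>b. b \<in> B \<Longrightarrow> norm b = 1" "\<And>b. b \<in> B \<Longrightarrow> Y *v b = (b \<bullet> (Y *v b)) *\<^sub>R b"
    using symmetric_spectral[OF sym] by blast
  define r where "r b = sqrt (b \<bullet> (Y *v b))" for b
  define f where "f v = (\<Sum>b\<in>B. (r b * (b \<bullet> v)) *\<^sub>R b)" for v
  have lin: "linear f"
    by (rule linearI) (simp_all add: f_def inner_add_right algebra_simps sum.distrib scaleR_sum_right)
  define S where "S = matrix f"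
  have S: "S *v v = f v" for v by (simp add: S_def lin matrix_works)
  have bb: "b \<bullet> c = (if b = c then 1 else 0)" if "b \<in> B" "c \<in> B" for b c
    using B(3,4) that by (auto simp: pairwise_def orthogonal_def norm_eq_1)
  have pos: "b \<bullet> (Y *v b) > 0" if "b \<in> B" for b
  proof -
    have "b \<noteq> 0" using B(4)[OF that] by auto
    then show ?thesis using assms by (simp add: posdef_def)
  qed
  have fb: "f b = r b *\<^sub>R b" if "b \<in> B" for b
  proof -
    have "f b = (\<Sum>c\<in>B. if c = b then r b *\<^sub>R b else 0)"
      unfolding f_def by (rule sum.cong) (auto simp: bb that)
    then show ?thesis using B(1) that by simp
  qed
  have "f (f v) = Y *v v" for v
  proof (rule linear_eq_on_span[of "f \<circ> f" "(*v) Y" B v, unfolded comp_def])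
    show "linear (\<lambda>x. f (f x))" using linear_compose[OF lin lin] by (simp add: comp_def)
    show "linear ((*v) Y)" by simp
    show "v \<in> span B" using B(2) by simp
    fix b assume b: "b \<in> B"
    have "f (f b) = (r b * r b) *\<^sub>R b" using fb[OF b] linear_scale[OF lin] by simp
    also have "\<dots> = Y *v b" using pos[OF b] B(5)[OF b] by (simp add: r_def)
    finally show "f (f b) = Y *v b" .
  qed
  then have "S ** S = Y" by (simp add: matrix_eq S matrix_vector_mul_assoc[symmetric])
  moreover have "posdef S"
    unfolding posdef_def
  proof (intro conjI allI impI)
    have "x \<bullet> f y = f x \<bullet> y" for x y
      by (simp add: f_def inner_sum_left inner_sum_right mult_ac inner_commute)
    then have "(S *v x) \<bullet> y = (transpose S *v x) \<bullet> y" for x y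
      by (metis S dot_lmul_matrix vector_transpose_matrix transpose_transpose)
    then show "transpose S = S" by (metis matrix_eq vector_eq_rdot)
    fix v :: "real^'n" assume "v \<noteq> 0"
    have "\<exists>b\<in>B. b \<bullet> v \<noteq> 0"
    proof (rule ccontr)
      assume "\<not> ?thesis"
      then have "orthogonal v b" if "b \<in> B" for b
        using that by (auto simp: orthogonal_def inner_commute)
      then have "orthogonal v v" using B(2) orthogonal_to_span[of v B v] by auto
      with \<open>v \<noteq> 0\<close> show False by (simp add: orthogonal_def)
    qed
    then obtain b where b: "b \<in> B" "b \<bullet> v \<noteq> 0" by blast
    have "v \<bullet> (S *v v) = (\<Sum>b\<in>B. r b * (b \<bullet> v)\<^sup>2)"
      by (simp add: S f_def inner_sum_right power2_eq_square inner_commute mult_ac)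
    also have "\<dots> > 0"
    proof (rule sum_pos2[of _ b])
      show "0 < r b * (b \<bullet> v)\<^sup>2" using b pos[OF b(1)] by (simp add: r_def)
      show "0 \<le> r c * (c \<bullet> v)\<^sup>2" if "c \<in> B" for c using pos[OF that] by (simp add: r_def)
    qed (use B b in auto)
    finally show "0 < v \<bullet> (S *v v)" .
  qed
  ultimately show ?thesis by blast
qed

lemma posdef_sqrt_unique:
  fixes S T :: "real^'n^'n"
  assumes S: "posdef S" and T: "posdef T" and eq: "S ** S = T ** T"
  shows "S = T"
proof -
  have symS: "transpose S = S" and symT: "transpose T = T" using S T by (auto simp: posdef_def)
  have "transpose (S - T) = S - T"
    using symS symT by (simp add: transpose_def vec_eq_iff)
  then obtain B where B: "span B = UNIV" "\<And>b. b \<in> B \<Longrightarrow> norm b = 1"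
    "\<And>b. b \<in> B \<Longrightarrow> (S - T) *v b = (b \<bullet> ((S - T) *v b)) *\<^sub>R b"
    using symmetric_spectral[of "S - T"] by metis
  have z: "S *v b = T *v b" if b: "b \<in> B" for b
  proof -
    define m where "m = b \<bullet> ((S - T) *v b)"
    have "S *v b - T *v b = m *\<^sub>R b"
      using B(3)[OF b] by (simp add: m_def matrix_vector_mult_diff_rdistrib)
    then have d: "S *v b = T *v b + m *\<^sub>R b" by (simp add: algebra_simps)
    have "b \<noteq> 0" using B(2)[OF b] by auto
    then have p: "b \<bullet> (S *v b) > 0" "b \<bullet> (T *v b) > 0" using S T by (auto simp: posdef_def)
    have "(S *v b) \<bullet> (S *v b) = (T *v b) \<bullet> (T *v b)"
      using eq symmetric_inner[OF symS, of b "S *v b"] symmetric_inner[OF symT, of b "T *v b"]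
      by (simp add: matrix_vector_mul_assoc)
    moreover have "(S *v b) \<bullet> (S *v b) - (T *v b) \<bullet> (T *v b) = m * (b \<bullet> (S *v b) + b \<bullet> (T *v b))"
      by (simp add: d inner_add_left inner_add_right inner_commute algebra_simps)
    ultimately have "m = 0" using p by auto
    with d show ?thesis by simp
  qed
  have "S *v v = T *v v" for v
    by (rule linear_eq_on_span[of "(*v) S" "(*v) T" B v]) (use z B(1) in auto)
  then show ?thesis by (simp add: matrix_eq)
qed

lemma posdef_sqrt:
  assumes "posdef Y"
  shows "posdef (posdef_sqrt Y)" "posdef_sqrt Y ** posdef_sqrt Y = Y"
proof -
  have "\<exists>!S. posdef S \<and> S ** S = Y"
    using posdef_sqrt_exists[OF assms] posdef_sqrt_unique by metis
  from theI'[OF this] show "posdef (posdef_sqrt Y)" "posdef_sqrt Y ** posdef_sqrt Y = Y"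
    by (auto simp: posdef_sqrt_def)
qed

end

theory Submission
  imports Defs
begin

text \<open>Let \<open>W\<close> lie in both bisectors, let \<open>v\<^sub>i\<close> and \<open>c\<^sub>i\<close> be the images under \<open>W\<^sup>1\<^sup>/\<^sup>2\<close> of the columns of \<open>g\<^sub>X\<close> and
  \<open>g\<^sub>Z\<close>, and let \<open>K\<close> be the right-hand side of the angle condition. The equation
  \<open>s(X, W) = s(Y, W)\<close> reads \<open>\<Sum>\<^sub>i |v\<^sub>i|\<^sup>2 (1 / x\<^sub>i - 1) = 0\<close>, and the chamber condition on \<open>x\<close> turns it
  into the statement that the part of \<open>v\<close> outside \<open>I\<close> is more than \<open>K\<close> times as long as the part
  inside \<open>I\<close>; for \<open>c\<close> the roles of \<open>I\<close> and its complement are exchanged. But \<open>c\<close> arises from \<open>v\<close>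
  by the orthogonal matrix \<open>R = g\<^sub>X\<^sup>T Y g\<^sub>Z\<close> of inner products of the columns of \<open>Y\<^sup>1\<^sup>/\<^sup>2 g\<^sub>X\<close> and
  \<open>Y\<^sup>1\<^sup>/\<^sup>2 g\<^sub>Z\<close>. Its diagonal is at least \<open>cos \<theta>\<close>, so the block exchanging \<open>I\<close> and its complement has
  Frobenius norm at most \<open>e = \<surd>(n - 2) sin \<theta>\<close>, which is too small for such an exchange as soon as
  \<open>K (1 - e) \<ge> 1\<close>.\<close>

section \<open>Norms of families recombined by an orthogonal matrix\<close>

text \<open>Expand the squares and sum over \<open>i\<close> first: orthonormality of the rows of
  \<open>R\<close> removes the mixed terms \<open>v j \<bullet> v k\<close>.\<close>

lemma sum_norm_orthogonal_combination:
  fixes v :: "'n::finite \<Rightarrow> 'a::real_inner" and R :: "real^'n^'n"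
  assumes "orthogonal_matrix R"
  shows "(\<Sum>i\<in>UNIV. (norm (\<Sum>j\<in>A. R $ j $ i *\<^sub>R v j))\<^sup>2) = (\<Sum>j\<in>A. (norm (v j))\<^sup>2)"
proof -
  have "R ** transpose R = mat 1"
    using assms by (simp add: orthogonal_matrix_def)
  then have rows: "(\<Sum>i\<in>UNIV. R $ j $ i * R $ k $ i) = (if j = k then 1 else 0)" for j k
    by (simp add: matrix_matrix_mult_def transpose_def mat_def vec_eq_iff)
  have "(\<Sum>i\<in>UNIV. (norm (\<Sum>j\<in>A. R $ j $ i *\<^sub>R v j))\<^sup>2) =
    (\<Sum>i\<in>UNIV. \<Sum>k\<in>A. \<Sum>j\<in>A. (R $ j $ i * R $ k $ i) * (v j \<bullet> v k))"
    by (simp add: power2_norm_eq_inner inner_sum_left inner_sum_right mult_ac inner_commute)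
  also have "\<dots> = (\<Sum>k\<in>A. \<Sum>j\<in>A. (\<Sum>i\<in>UNIV. R $ j $ i * R $ k $ i) * (v j \<bullet> v k))"
    unfolding sum_distrib_right
    by (subst sum.swap, rule sum.cong[OF refl], rule sum.swap)
  also have "\<dots> = (\<Sum>k\<in>A. \<Sum>j\<in>A. if j = k then v k \<bullet> v k else 0)"
    by (intro sum.cong refl) (simp add: rows)
  finally show ?thesis
    by (simp add: power2_norm_eq_inner)
qed

lemma norm_sum_scaleR_le_L2_set:
  fixes v :: "'i \<Rightarrow> 'a::real_normed_vector"
  shows "norm (\<Sum>j\<in>A. r j *\<^sub>R v j) \<le> L2_set r A * L2_set (\<lambda>j. norm (v j)) A"
proof -
  have "norm (\<Sum>j\<in>A. r j *\<^sub>R v j) \<le> (\<Sum>j\<in>A. \<bar>r j\<bar> * \<bar>norm (v j)\<bar>)"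
    using norm_sum[of "\<lambda>j. r j *\<^sub>R v j" A] by simp
  also have "\<dots> \<le> L2_set r A * L2_set (\<lambda>j. norm (v j)) A"
    by (rule L2_set_mult_ineq)
  finally show ?thesis .
qed

text \<open>Each combination splits into its terms from \<open>I\<close> and from
  \<open>- I\<close>. The first family does not grow, by the isometry above; the second is bounded
  by Cauchy-Schwarz and the Frobenius norm of the block of \<open>R\<close> that mixes
  \<open>- I\<close> into \<open>I\<close>.\<close>

lemma L2_set_orthogonal_combination_le:
  fixes v :: "'n::finite \<Rightarrow> 'a::real_inner" and R :: "real^'n^'n"
  assumes R: "orthogonal_matrix R"
    and e: "0 \<le> e" "(\<Sum>i\<in>I. \<Sum>j\<in>-I. (R $ j $ i)\<^sup>2) \<le> e\<^sup>2"
  shows "L2_set (\<lambda>i. norm (\<Sum>j\<in>UNIV. R $ j $ i *\<^sub>R v j)) I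
    \<le> L2_set (\<lambda>j. norm (v j)) I + e * L2_set (\<lambda>j. norm (v j)) (- I)"
proof -
  define a where "a i = (\<Sum>j\<in>I. R $ j $ i *\<^sub>R v j)" for i
  define b where "b i = (\<Sum>j\<in>-I. R $ j $ i *\<^sub>R v j)" for i
  define y where "y = L2_set (\<lambda>j. norm (v j)) (- I)"
  have y: "0 \<le> y"
    by (simp add: y_def)
  have split: "(\<Sum>j\<in>UNIV. R $ j $ i *\<^sub>R v j) = a i + b i" for i
    unfolding a_def b_def by (subst sum.union_disjoint[symmetric]) auto
  have "L2_set (\<lambda>i. norm (\<Sum>j\<in>UNIV. R $ j $ i *\<^sub>R v j)) I
      \<le> L2_set (\<lambda>i. norm (a i) + norm (b i)) I"
    unfolding split by (intro L2_set_mono norm_triangle_ineq) auto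
  also have "\<dots> \<le> L2_set (\<lambda>i. norm (a i)) I + L2_set (\<lambda>i. norm (b i)) I"
    by (rule L2_set_triangle_ineq)
  also have "L2_set (\<lambda>i. norm (a i)) I \<le> L2_set (\<lambda>j. norm (v j)) I"
    unfolding L2_set_def
  proof (rule real_sqrt_le_mono)
    have "(\<Sum>i\<in>I. (norm (a i))\<^sup>2) \<le> (\<Sum>i\<in>UNIV. (norm (a i))\<^sup>2)"
      by (rule sum_mono2) auto
    then show "(\<Sum>i\<in>I. (norm (a i))\<^sup>2) \<le> (\<Sum>j\<in>I. (norm (v j))\<^sup>2)"
      using sum_norm_orthogonal_combination[OF R, of v I] by (simp add: a_def)
  qed
  also have "L2_set (\<lambda>i. norm (b i)) I \<le> e * y"
  proof -
    have "L2_set (\<lambda>i. norm (b i)) I \<le> L2_set (\<lambda>i. L2_set (\<lambda>j. R $ j $ i) (- I) * y) I"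
      unfolding b_def y_def by (intro L2_set_mono norm_sum_scaleR_le_L2_set) auto
    also have "\<dots> = L2_set (\<lambda>i. L2_set (\<lambda>j. R $ j $ i) (- I)) I * y"
      using y by (rule L2_set_left_distrib[symmetric])
    also have "L2_set (\<lambda>i. L2_set (\<lambda>j. R $ j $ i) (- I)) I \<le> e"
      using e by (simp add: L2_set_def real_le_lsqrt real_sqrt_pow2 sum_nonneg)
    finally show ?thesis
      using y by (simp add: mult_right_mono)
  qed
  finally show ?thesis
    by (simp add: y_def)
qed

section \<open>Weighted sums under the chamber condition\<close>

text \<open>Convexity of \<open>exp\<close> on the segment between \<open>0\<close> and
  \<open>- M\<close>.\<close>

lemma one_minus_exp_concave:
  fixes t M :: real
  assumes "0 \<le> t" "t \<le> 1"
  shows "t * (1 - exp (- M)) \<le> 1 - exp (- (t * M))"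
proof -
  have "exp ((1 - t) *\<^sub>R 0 + t *\<^sub>R (- M)) \<le> (1 - t) * exp 0 + t * exp (- M)"
    by (rule convex_onD[OF exp_convex]) (use assms in auto)
  then show ?thesis
    by (simp add: algebra_simps)
qed

lemma prod_eq_1_sign_set_proper:
  fixes x :: "real^'n"
  assumes "\<And>i. 0 < x $ i" "(\<Prod>i\<in>UNIV. x $ i) = 1"
    and "\<And>i. i \<in> J \<Longrightarrow> x $ i < 1" "\<And>i. i \<notin> J \<Longrightarrow> 1 < x $ i"
  shows "J \<noteq> {}" "J \<noteq> UNIV"
proof -
  show "J \<noteq> {}"
  proof
    assume "J = {}"
    then have "1 < (\<Prod>i\<in>UNIV. x $ i)"
      using assms(4) by (intro less_1_prod) auto
    then show False
      using assms(2) by simp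
  qed
  show "J \<noteq> UNIV"
  proof
    assume J: "J = UNIV"
    have "(\<Prod>i\<in>UNIV. x $ i) < (\<Prod>i\<in>(UNIV :: 'n set). 1)"
      using assms(1,3) J by (intro prod_mono_strict) (auto intro: less_imp_le)
    then show False
      using assms(2) by simp
  qed
qed

lemma diag_inject: "diag x = diag y \<longleftrightarrow> x = y"
proof
  assume "diag x = diag y"
  then have "diag x $ i $ i = diag y $ i $ i" for i
    by simp
  then show "x = y"
    by (simp add: diag_def vec_eq_iff)
qed simp

lemma chamber_t_diagD:
  assumes "diag x \<in> chamber_t J t"
  shows "0 < x $ i" "(\<Prod>i\<in>UNIV. x $ i) = 1"
    "i \<in> J \<Longrightarrow> x $ i < 1" "i \<notin> J \<Longrightarrow> 1 < x $ i"
    "t \<le> Min (range (\<lambda>i. \<bar>ln (x $ i)\<bar>)) / Max (range (\<lambda>i. \<bar>ln (x $ i)\<bar>))"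
    "J \<noteq> {}" "J \<noteq> UNIV"
proof -
  show 1: "0 < x $ i" "(\<Prod>i\<in>UNIV. x $ i) = 1"
    "i \<in> J \<Longrightarrow> x $ i < 1" "i \<notin> J \<Longrightarrow> 1 < x $ i" for i
    using assms unfolding chamber_t_def chamber_def F_mod_def by (auto simp: diag_inject)
  show "t \<le> Min (range (\<lambda>i. \<bar>ln (x $ i)\<bar>)) / Max (range (\<lambda>i. \<bar>ln (x $ i)\<bar>))"
    using assms unfolding chamber_t_def by (auto simp: diag_inject)
  show "J \<noteq> {}" "J \<noteq> UNIV"
    using prod_eq_1_sign_set_proper[of x J] 1 by blast+
qed

text \<open>The equation for \<open>w\<close> balances the excess \<open>1 / x $ i - 1\<close> on
  \<open>J\<close> against the deficit outside. With \<open>M\<close> the largest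
  \<open>\<bar>ln (x $ i)\<bar>\<close>, the excess is at least \<open>exp (t * M) - 1\<close> and
  the deficit at most \<open>1 - exp (- M)\<close>; a trace of at least \<open>L\<close> forces
  \<open>M\<close> to be large.\<close>

lemma chamber_t_weights:
  fixes x :: "real^'n" and w :: "'n \<Rightarrow> real"
  assumes x: "diag x \<in> chamber_t J t" and t: "0 < t" "t < 1"
    and w: "\<And>i. 0 < w i" "(\<Sum>i\<in>UNIV. w i / x $ i) = (\<Sum>i\<in>UNIV. w i)"
    and L: "1 < L" "L \<le> (\<Sum>i\<in>UNIV. x $ i)"
  shows "t * ((L - 1) / (real CARD('n) - 1)) powr t * (\<Sum>i\<in>J. w i) < (\<Sum>i\<in>-J. w i)"
proof -
  note D = chamber_t_diagD[OF x]
  define M where "M = Max (range (\<lambda>i. \<bar>ln (x $ i)\<bar>))"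
  define m where "m = Min (range (\<lambda>i. \<bar>ln (x $ i)\<bar>))"
  define \<Lambda> where "\<Lambda> = (L - 1) / (real CARD('n) - 1)"
  have leM: "\<bar>ln (x $ i)\<bar> \<le> M" for i
    unfolding M_def by (rule Max_ge) auto
  have gem: "m \<le> \<bar>ln (x $ i)\<bar>" for i
    unfolding m_def by (rule Min_le) auto
  obtain k where k: "k \<in> J"
    using D(6) by blast
  obtain l where l: "l \<notin> J"
    using D(7) by blast
  have "0 < ln (x $ l)"
    using D(4)[OF l] by simp
  then have M: "0 < M"
    using leM[of l] by linarith
  have tM: "t * M \<le> m"
    using D(5) M by (simp add: M_def[symmetric] m_def[symmetric] pos_le_divide_eq)
  have inJ: "exp (t * M) \<le> 1 / x $ i" if "i \<in> J" for i
  proof -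
    have "ln (x $ i) < 0"
      using D(1,3)[of i] that by simp
    then have "t * M \<le> ln (1 / x $ i)"
      using gem[of i] tM D(1)[of i] by (simp add: ln_div)
    then show ?thesis
      using D(1)[of i] by (metis exp_le_cancel_iff exp_ln zero_less_divide_1_iff)
  qed
  have upM: "x $ i \<le> exp M" for i
  proof -
    have "ln (x $ i) \<le> M"
      using leM[of i] by linarith
    then show ?thesis
      using D(1)[of i] by (metis exp_le_cancel_iff exp_ln)
  qed
  have notJ: "exp (- M) \<le> 1 / x $ i" for i
    using upM[of i] D(1)[of i] by (simp add: exp_minus inverse_eq_divide frac_le)
  have E: "0 < 1 - exp (- M)"
    using M by simp
  have "(exp (t * M) - 1) * (\<Sum>i\<in>J. w i) \<le> (\<Sum>i\<in>J. (1 / x $ i - 1) * w i)"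
    unfolding sum_distrib_left
    by (intro sum_mono mult_right_mono) (use inJ w in \<open>auto intro: less_imp_le\<close>)
  also have "\<dots> = (\<Sum>i\<in>-J. (1 - 1 / x $ i) * w i)"
  proof -
    have "(\<Sum>i\<in>UNIV. (1 / x $ i - 1) * w i) = 0"
      using w(2) by (simp add: algebra_simps sum_subtractf)
    moreover have "(\<Sum>i\<in>UNIV. (1 / x $ i - 1) * w i) =
        (\<Sum>i\<in>J. (1 / x $ i - 1) * w i) + (\<Sum>i\<in>-J. (1 / x $ i - 1) * w i)"
      by (subst sum.union_disjoint[symmetric]) auto
    ultimately have "(\<Sum>i\<in>J. (1 / x $ i - 1) * w i) = - (\<Sum>i\<in>-J. (1 / x $ i - 1) * w i)"
      by linarith
    then show ?thesis
      by (simp add: sum_negf[symmetric] algebra_simps)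
  qed
  also have "\<dots> \<le> (1 - exp (- M)) * (\<Sum>i\<in>-J. w i)"
    unfolding sum_distrib_left
    by (intro sum_mono mult_right_mono) (use notJ w in \<open>auto intro: less_imp_le\<close>)
  finally have 1: "(exp (t * M) - 1) * (\<Sum>i\<in>J. w i) \<le> (1 - exp (- M)) * (\<Sum>i\<in>-J. w i)" .
  have wJ: "0 < (\<Sum>i\<in>J. w i)"
    using w(1) D(6) by (intro sum_pos) auto
  \<comment> \<open>Writing \<open>exp (t * M) - 1\<close> as
    \<open>exp (t * M) * (1 - exp (- (t * M)))\<close> exposes, by concavity, the factor
    \<open>1 - exp (- M)\<close>, which then cancels.\<close>
  have "exp (t * M) * (t * (1 - exp (- M))) \<le> exp (t * M) * (1 - exp (- (t * M)))"
    using one_minus_exp_concave[of t M] t by (intro mult_left_mono) auto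
  then have "(1 - exp (- M)) * (t * exp (t * M)) \<le> exp (t * M) - 1"
    by (simp add: algebra_simps exp_minus)
  then have "(1 - exp (- M)) * (t * exp (t * M)) * (\<Sum>i\<in>J. w i) \<le> (1 - exp (- M)) * (\<Sum>i\<in>-J. w i)"
    using 1 wJ by (meson mult_right_mono less_imp_le order_trans)
  then have 2: "t * exp (t * M) * (\<Sum>i\<in>J. w i) \<le> (\<Sum>i\<in>-J. w i)"
    using E by (simp add: mult.assoc)
  have "card {k, l} \<le> CARD('n)"
    by (rule card_mono) auto
  then have n: "real CARD('n) - 1 > 0"
    using k l by (cases "k = l") auto
  \<comment> \<open>Setting aside one entry from \<open>J\<close>, which is below 1, yields both the
    factor \<open>CARD('n) - 1\<close> and the strict inequality.\<close>
  have "(\<Sum>i\<in>UNIV. x $ i) = x $ k + (\<Sum>i\<in>UNIV - {k}. x $ i)"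
    by (subst sum.remove[of _ k]) auto
  also have "\<dots> < 1 + (\<Sum>i\<in>UNIV - {k}. exp M)"
    using D(3)[OF k] by (intro add_less_le_mono sum_mono upM)
  also have "\<dots> = 1 + (real CARD('n) - 1) * exp M"
    using n by (simp add: card_Diff_singleton of_nat_diff)
  finally have "L - 1 < (real CARD('n) - 1) * exp M"
    using L by simp
  then have "\<Lambda> < exp M"
    using n by (simp add: \<Lambda>_def divide_simps mult.commute)
  moreover have "0 < \<Lambda>"
    using L n by (simp add: \<Lambda>_def)
  ultimately have "\<Lambda> powr t < exp M powr t"
    using t by (intro powr_less_mono2) auto
  also have "exp M powr t = exp (t * M)"
    by (simp add: powr_def)
  finally have "t * \<Lambda> powr t * (\<Sum>i\<in>J. w i) < t * exp (t * M) * (\<Sum>i\<in>J. w i)"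
    using t wJ by simp
  with 2 show ?thesis
    by (simp add: \<Lambda>_def)
qed

section \<open>Selberg's invariant in a diagonalising frame\<close>

text \<open>A one-sided inverse of a square matrix is two-sided, so \<open>transpose g\<close> may
  move from the left end of the product to the right end.\<close>

lemma congruence_inverse:
  fixes g A :: "real^'n^'n"
  assumes "act g A = D" "D ** E = mat 1"
  shows "matrix_inv A = g ** E ** transpose g" "A ** (g ** E ** transpose g) = mat 1"
proof -
  have "transpose g ** (A ** g ** E) = mat 1"
    using assms by (simp add: act_def matrix_mul_assoc)
  then have "(A ** g ** E) ** transpose g = mat 1"
    by (simp add: matrix_left_right_inverse)
  then show 1: "A ** (g ** E ** transpose g) = mat 1"
    by (simp add: matrix_mul_assoc)
  then have 2: "(g ** E ** transpose g) ** A = mat 1"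
    by (simp add: matrix_left_right_inverse)
  \<comment> \<open>\<open>matrix_inv\<close> is a choice, so an explicit two-sided inverse first
    gives its defining equations; uniqueness of inverses then identifies it.\<close>
  then have "A ** matrix_inv A = mat 1 \<and> matrix_inv A ** A = mat 1"
    unfolding matrix_inv_def by (intro someI conjI) (rule 1)
  then show "matrix_inv A = g ** E ** transpose g"
    using 1 by (metis matrix_mul_assoc matrix_mul_lid matrix_mul_rid)
qed

lemma inner_column_mult:
  fixes g h W :: "real^'n^'n"
  shows "(transpose g ** W ** h) $ i $ j = column i g \<bullet> (W *v column j h)"
proof -
  have "(transpose g ** (W ** h)) $ i $ j = column i g \<bullet> column j (W ** h)"
    by (simp add: matrix_matrix_mult_def transpose_def column_def inner_vec_def)
  moreover have "column j (W ** h) = W *v column j h"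
    by (simp add: matrix_matrix_mult_def matrix_vector_mult_def column_def vec_eq_iff)
  ultimately show ?thesis
    by (simp add: matrix_mul_assoc)
qed

lemma trace_diag_mult: "trace (diag e ** B) = (\<Sum>i\<in>UNIV. e $ i * B $ i $ i)"
  by (simp add: trace_def matrix_matrix_mult_def diag_def if_distrib[of "\<lambda>x. x * _"] cong: if_cong)

lemma diag_mult_diag: "diag a ** diag b = diag (\<chi> i. a $ i * b $ i)"
  by (auto simp: matrix_matrix_mult_def diag_def vec_eq_iff if_distrib[of "\<lambda>x. x * _"] cong: if_cong)

text \<open>Cyclicity of the trace gives the trace of the inverse of \<open>diag d\<close> times the
  Gram matrix of the form \<open>W\<close> on the columns of \<open>g\<close>.\<close>

lemma selberg_diag:
  fixes g A W :: "real^'n^'n"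
  assumes "act g A = diag d" "\<And>i. d $ i \<noteq> 0"
  shows "selberg A W = (\<Sum>i\<in>UNIV. (column i g \<bullet> (W *v column i g)) / d $ i)"
proof -
  define e where "e = (\<chi> i. inverse (d $ i))"
  have "diag d ** diag e = mat 1"
    using assms(2) by (simp add: diag_mult_diag e_def) (simp add: diag_def mat_def vec_eq_iff)
  from congruence_inverse(1)[OF assms(1) this]
  have "selberg A W = trace (g ** (diag e ** (transpose g ** W)))"
    by (simp add: selberg_def matrix_mul_assoc)
  also have "\<dots> = trace (diag e ** (transpose g ** W ** g))"
    by (subst trace_mul_sym) (simp add: matrix_mul_assoc)
  also have "\<dots> = (\<Sum>i\<in>UNIV. (column i g \<bullet> (W *v column i g)) / d $ i)"
    by (simp add: trace_diag_mult inner_column_mult e_def divide_inverse mult.commute)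
  finally show ?thesis .
qed

lemma mat_1_eq_diag: "mat 1 = diag 1"
  by (simp add: mat_def diag_def vec_eq_iff)

lemma selberg_mat_1:
  fixes g A W :: "real^'n^'n"
  assumes "act g A = mat 1"
  shows "selberg A W = (\<Sum>i\<in>UNIV. column i g \<bullet> (W *v column i g))"
  using selberg_diag[of g A 1 W] assms by (simp add: mat_1_eq_diag)

lemma posdef_norm_posdef_sqrt:
  assumes "posdef W"
  shows "v \<bullet> (W *v v) = (norm (posdef_sqrt W *v v))\<^sup>2"
  using posdef_sqrt[OF assms] symmetric_inner[of "posdef_sqrt W" v "posdef_sqrt W *v v"]
  by (simp add: posdef_def matrix_vector_mul_assoc power2_norm_eq_inner)

lemma act_mat_1_column_nonzero:
  assumes "act g A = mat 1"
  shows "column i g \<noteq> 0"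
proof
  assume "column i g = 0"
  moreover have "act g A $ i $ i = 1"
    using assms by (simp add: mat_def)
  ultimately show False
    by (simp add: act_def inner_column_mult)
qed

section \<open>Incompatibility of the two cones\<close>

text \<open>The vectors \<open>(x, y)\<close> and \<open>(q, r)\<close> have the same length; the first lies in the
  cone \<open>K x < y\<close> near the second axis, the second in the cone \<open>K r < q\<close> near the first axis,
  but the inequality \<open>q \<le> x + e y\<close> leaves no room to get from one cone to the other.\<close>

lemma cone_transition_impossible:
  fixes x y q r e K :: real
  assumes "0 \<le> x" "0 \<le> y" "0 \<le> q" "0 < K" "0 \<le> e" "1 \<le> K * (1 - e)"
    and "q \<le> x + e * y" and "q\<^sup>2 + r\<^sup>2 = x\<^sup>2 + y\<^sup>2"
    and "K\<^sup>2 * x\<^sup>2 < y\<^sup>2" and "K\<^sup>2 * r\<^sup>2 < q\<^sup>2"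
  shows False
proof -
  have "(K * x)\<^sup>2 < y\<^sup>2"
    using assms(9) by (simp add: power_mult_distrib)
  then have Kx: "K * x < y"
    using assms(2) by (rule power_less_imp_less_base)
  have "K * (e * y) \<le> (K - 1) * y"
    using mult_right_mono[OF assms(6,2)] by (simp add: algebra_simps)
  moreover have "K * q \<le> K * (x + e * y)"
    using assms(4,7) by simp
  ultimately have Kq: "K * q \<le> K * x + (K - 1) * y"
    by (simp add: algebra_simps)
  have "K * e \<ge> 0"
    using assms by simp
  then have K: "1 \<le> K"
    using assms(6) by (simp add: algebra_simps)
  \<comment> \<open>The gap \<open>u\<close> measures how far \<open>(x, y)\<close> is inside its
    cone; the bound on \<open>q\<close> becomes \<open>K * q \<le> K * y - u\<close>.\<close>
  define u where "u = y - K * x"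
  have u: "0 < u" "u \<le> y"
    using Kx assms by (auto simp: u_def)
  have "K * q \<le> K * y - u"
    using Kq by (simp add: u_def algebra_simps)
  then have sq: "(K * q)\<^sup>2 \<le> (K * y - u)\<^sup>2"
    using assms by (intro power_mono) auto
  \<comment> \<open>Eliminates \<open>r\<close> through the equal lengths.\<close>
  have "K\<^sup>2 * (x\<^sup>2 + y\<^sup>2) < q\<^sup>2 * (1 + K\<^sup>2)"
    using assms(10) by (simp add: assms(8)[symmetric] algebra_simps)
  then have "K\<^sup>2 * (K\<^sup>2 * (x\<^sup>2 + y\<^sup>2)) < K\<^sup>2 * (q\<^sup>2 * (1 + K\<^sup>2))"
    using assms(4) by (intro mult_strict_left_mono) auto
  also have "\<dots> = (K * q)\<^sup>2 * (1 + K\<^sup>2)"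
    by (simp add: power_mult_distrib)
  also have "\<dots> \<le> (K * y - u)\<^sup>2 * (1 + K\<^sup>2)"
    using sq by (intro mult_right_mono) auto
  finally have "K\<^sup>2 * (K * x)\<^sup>2 + K^4 * y\<^sup>2 < (K * y - u)\<^sup>2 * (1 + K\<^sup>2)"
    by (simp add: algebra_simps power_mult_distrib power4_eq_xxxx power2_eq_square)
  moreover have "K * x = y - u"
    by (simp add: u_def)
  ultimately have "K\<^sup>2 * (y - u)\<^sup>2 + K^4 * y\<^sup>2 < (K * y - u)\<^sup>2 * (1 + K\<^sup>2)"
    by simp
  \<comment> \<open>All terms free of \<open>u\<close> cancel, so \<open>u\<close> factors out; the
    cofactor is nonpositive because \<open>u \<le> y\<close> and \<open>1 \<le> K\<close>.\<close>
  then have lt: "0 < u * (u - 2 * K * y - 2 * K ^ 3 * y + 2 * K\<^sup>2 * y)"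
    by (simp add: algebra_simps power2_eq_square power3_eq_cube power4_eq_xxxx)
  have "K\<^sup>2 * y \<le> K ^ 3 * y"
    using K assms(2) by (intro mult_right_mono power_increasing) auto
  moreover have "y \<le> K * y"
    using K assms(2) mult_right_mono[of 1 K y] by simp
  ultimately have "u - 2 * K * y - 2 * K ^ 3 * y + 2 * K\<^sup>2 * y \<le> 0"
    using u assms(2) by linarith
  then show False
    using lt u(1) by (meson mult_nonneg_nonpos less_imp_le not_less)
qed

section \<open>The rotation between the frames and the column angle\<close>

text \<open>Rows and columns are unit vectors, so off the diagonal each has squared length at most
  \<open>1 - (cos \<theta>)\<^sup>2\<close>. The block is estimated by its columns or by its rows,
  whichever are fewer.\<close>

lemma orthogonal_matrix_off_diagonal_block:
  fixes R :: "real^'n^'n"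
  assumes R: "orthogonal_matrix R" and n: "CARD('n) \<ge> 3"
    and c: "0 \<le> cos \<theta>" "\<And>i. cos \<theta> \<le> R $ i $ i"
  shows "(\<Sum>i\<in>I. \<Sum>j\<in>-I. (R $ j $ i)\<^sup>2) \<le> (sqrt (real CARD('n) - 2) * sin \<theta>)\<^sup>2"
proof -
  have diag: "(cos \<theta>)\<^sup>2 \<le> (R $ i $ i)\<^sup>2" for i
    using c by (intro power_mono) auto
  have "transpose R ** R = mat 1" "R ** transpose R = mat 1"
    using R by (auto simp: orthogonal_matrix_def)
  then have "(transpose R ** R) $ i $ i = 1" "(R ** transpose R) $ i $ i = 1" for i
    by (simp_all add: mat_def)
  then have norms: "(\<Sum>j\<in>UNIV. (R $ j $ i)\<^sup>2) = 1" "(\<Sum>j\<in>UNIV. (R $ i $ j)\<^sup>2) = 1" for i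
    by (simp_all add: matrix_matrix_mult_def transpose_def power2_eq_square)
  have col: "(\<Sum>j\<in>-I. (R $ j $ i)\<^sup>2) \<le> (sin \<theta>)\<^sup>2" if "i \<in> I" for i
  proof -
    have "(\<Sum>j\<in>-I. (R $ j $ i)\<^sup>2) + (R $ i $ i)\<^sup>2 = (\<Sum>j\<in>insert i (-I). (R $ j $ i)\<^sup>2)"
      using that by simp
    also have "\<dots> \<le> 1"
      unfolding norms(1)[of i, symmetric] by (rule sum_mono2) auto
    finally show ?thesis
      using diag[of i] by (simp add: sin_squared_eq)
  qed
  have row: "(\<Sum>i\<in>I. (R $ j $ i)\<^sup>2) \<le> (sin \<theta>)\<^sup>2" if "j \<in> -I" for j
  proof -
    have "(\<Sum>i\<in>I. (R $ j $ i)\<^sup>2) + (R $ j $ j)\<^sup>2 = (\<Sum>i\<in>insert j I. (R $ j $ i)\<^sup>2)"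
      using that by simp
    also have "\<dots> \<le> 1"
      unfolding norms(2)[of j, symmetric] by (rule sum_mono2) auto
    finally show ?thesis
      using diag[of j] by (simp add: sin_squared_eq)
  qed
  have b1: "(\<Sum>i\<in>I. \<Sum>j\<in>-I. (R $ j $ i)\<^sup>2) \<le> real (card I) * (sin \<theta>)\<^sup>2"
    using sum_mono[OF col, of I] by simp
  have b2: "(\<Sum>i\<in>I. \<Sum>j\<in>-I. (R $ j $ i)\<^sup>2) \<le> real (card (-I)) * (sin \<theta>)\<^sup>2"
    by (subst sum.swap) (use sum_mono[OF row, of "-I"] in simp)
  \<comment> \<open>Here dimension at least 3 enters: for a split of two indices into 1 and 1
    neither count would be at most 0.\<close>
  have "card I + card (-I) = CARD('n)"
    by (subst card_Un_disjoint[symmetric]) auto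
  then consider "card I \<le> CARD('n) - 2" | "card (-I) \<le> CARD('n) - 2"
    using n by linarith
  then have "(\<Sum>i\<in>I. \<Sum>j\<in>-I. (R $ j $ i)\<^sup>2) \<le> real (CARD('n) - 2) * (sin \<theta>)\<^sup>2"
    using b1 b2 by cases (meson mult_right_mono of_nat_mono order_trans zero_le_power2)+
  then show ?thesis
    using n by (simp add: power_mult_distrib of_nat_diff)
qed

lemma vangle_column_orthogonal:
  fixes A B :: "real^'n^'n"
  assumes "orthogonal_matrix A" "orthogonal_matrix B"
  shows "vangle (column i A) (column i B) = arccos (column i A \<bullet> column i B)"
    "\<bar>column i A \<bullet> column i B\<bar> \<le> 1"
proof -
  have n: "norm (column i A) = 1" "norm (column i B) = 1"
    using assms by (simp_all add: orthogonal_matrix_orthonormal_columns)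
  then show "vangle (column i A) (column i B) = arccos (column i A \<bullet> column i B)"
    by (simp add: vangle_def)
  show "\<bar>column i A \<bullet> column i B\<bar> \<le> 1"
    using Cauchy_Schwarz_ineq2[of "column i A" "column i B"] n by simp
qed

text \<open>Cosine decreases on the interval from 0 to \<open>pi\<close>, so the largest angle
  bounds all column inner products from below.\<close>

lemma max_column_angle_orthogonal:
  fixes A B :: "real^'n^'n"
  assumes A: "orthogonal_matrix A" and B: "orthogonal_matrix B"
  shows "0 \<le> max_column_angle A B" "max_column_angle A B \<le> pi"
    "cos (max_column_angle A B) \<le> column i A \<bullet> column i B"
proof -
  note v = vangle_column_orthogonal[OF A B]
  have bnd: "0 \<le> vangle (column i A) (column i B)" "vangle (column i A) (column i B) \<le> pi" for i
    unfolding v(1) using v(2)[of i] by (auto intro: arccos_lbound arccos_ubound)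
  have "max_column_angle A B \<in> range (\<lambda>i. vangle (column i A) (column i B))"
    unfolding max_column_angle_def by (rule Max_in) auto
  then show pi: "0 \<le> max_column_angle A B" "max_column_angle A B \<le> pi"
    using bnd by auto
  have "vangle (column i A) (column i B) \<le> max_column_angle A B"
    unfolding max_column_angle_def by (rule Max_ge) auto
  then have "cos (max_column_angle A B) \<le> cos (vangle (column i A) (column i B))"
    using bnd pi by (intro cos_monotone_0_pi_le)
  then show "cos (max_column_angle A B) \<le> column i A \<bullet> column i B"
    using v[of i] by (simp add: cos_arccos_abs)
qed

lemma orthogonal_posdef_sqrt_mult:
  fixes g Y :: "real^'n^'n"
  assumes "posdef Y" "act g Y = mat 1"
  shows "orthogonal_matrix (posdef_sqrt Y ** g)"
proof -
  have "transpose (posdef_sqrt Y ** g) ** (posdef_sqrt Y ** g)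
      = transpose g ** (posdef_sqrt Y ** posdef_sqrt Y) ** g"
    using posdef_sqrt(1)[OF assms(1)]
    by (simp add: matrix_transpose_mul posdef_def matrix_mul_assoc)
  also have "\<dots> = mat 1"
    using assms by (simp add: posdef_sqrt act_def)
  finally show ?thesis
    by (simp add: orthogonal_matrix)
qed

(* CARD('n) >= 3: for n = 2 the claim is false, e.g. for Y = I, X = diag(3,1/3),
   Z = R diag(1/3,3) R^T, R the rotation with cos = 4/5, t = 9/10; both bisectors contain a
   positive multiple of the matrix with rows (3,-4/3), (-4/3,1).
   Positive denominator: the angle condition is meant for small theta; if the denominator
   were allowed to be negative (or 0) it would hold vacuously. *)

theorem theorem4p2:
  fixes X Y Z gX gZ :: "real^'n^'n" and I :: "'n set" and t L \<theta> :: real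
  assumes "CARD('n) \<ge> 3"
    and "X \<in> PD" and "Y \<in> PD" and "Z \<in> PD"
    and "L = min (selberg Y X) (selberg Y Z)"
    and "gX \<in> SL" and "gZ \<in> SL"
    and "act gX Y = mat 1" and "act gZ Y = mat 1"
    and "act gX X \<in> F_mod" and "act gZ Z \<in> F_mod"
    and "\<theta> = max_column_angle (posdef_sqrt Y ** gX) (posdef_sqrt Y ** gZ)"
    and "0 < t" and "t < 1"
    and "act gX X \<in> chamber_t I t" and "act gZ Z \<in> chamber_t (- I) t"
    and "0 < cos \<theta> - sqrt (real CARD('n) - 2) * sin \<theta>"
    and "(1 + sqrt (real CARD('n) - 2) * sin \<theta>) / (cos \<theta> - sqrt (real CARD('n) - 2) * sin \<theta>)
         \<le> sqrt t * ((L - 1) / (real CARD('n) - 1)) powr (t / 2)"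
  shows "Bis X Y \<inter> Bis Y Z = {}"
proof (rule ccontr)
  assume "Bis X Y \<inter> Bis Y Z \<noteq> {}"
  then obtain W where W: "posdef W" "selberg X W = selberg Y W" "selberg Y W = selberg Z W"
    by (auto simp: Bis_def PD_def)
  have Y: "posdef Y"
    using assms(3) by (simp add: PD_def)
  obtain x where x: "act gX X = diag x" "diag x \<in> chamber_t I t"
    using assms(10,15) by (auto simp: F_mod_def)
  obtain z where z: "act gZ Z = diag z" "diag z \<in> chamber_t (- I) t"
    using assms(11,16) by (auto simp: F_mod_def)
  note Dx = chamber_t_diagD[OF x(2)] and Dz = chamber_t_diagD[OF z(2)]

  define A where "A = posdef_sqrt Y ** gX"
  define B where "B = posdef_sqrt Y ** gZ"
  have AB: "orthogonal_matrix A" "orthogonal_matrix B"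
    using Y assms(8,9) by (simp_all add: A_def B_def orthogonal_posdef_sqrt_mult)
  define R where "R = transpose A ** B"
  have R: "orthogonal_matrix R"
    using AB by (simp add: R_def orthogonal_matrix_mul orthogonal_matrix_transpose)
  have "transpose A ** B = transpose gX ** (posdef_sqrt Y ** posdef_sqrt Y) ** gZ"
    using posdef_sqrt(1)[OF Y] by (simp add: A_def B_def matrix_transpose_mul posdef_def matrix_mul_assoc)
  then have "gX ** R = gX ** transpose gX ** Y ** gZ"
    by (simp add: R_def posdef_sqrt(2)[OF Y] matrix_mul_assoc)
  \<comment> \<open>Since \<open>act gX Y\<close> is the identity, \<open>gX ** transpose gX\<close>
    inverts \<open>Y\<close>; thus \<open>R\<close> is the change of basis between the two
    frames.\<close>
  also have "gX ** transpose gX ** Y = mat 1"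
    using congruence_inverse(2)[OF assms(8), of "mat 1"]
    by (simp add: matrix_left_right_inverse)
  finally have gZ: "gZ = gX ** R"
    by simp

  define v where "v j = posdef_sqrt W *v column j gX" for j
  define c where "c i = posdef_sqrt W *v column i gZ" for i
  have c: "c i = (\<Sum>j\<in>UNIV. R $ j $ i *\<^sub>R v j)" for i
  proof -
    have "column i gZ = (\<Sum>j\<in>UNIV. R $ j $ i *\<^sub>R column j gX)"
      by (simp add: gZ matrix_matrix_mult_def column_def vec_eq_iff mult.commute)
    then show ?thesis
      by (simp add: c_def v_def linear_sum[OF matrix_vector_mul_linear] matrix_vector_mult_scaleR)
  qed
  have wv: "column i gX \<bullet> (W *v column i gX) = (norm (v i))\<^sup>2"
    and wc: "column i gZ \<bullet> (W *v column i gZ) = (norm (c i))\<^sup>2" for i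
    by (simp_all add: v_def c_def posdef_norm_posdef_sqrt[OF W(1)])
  have pos: "0 < (norm (v i))\<^sup>2" "0 < (norm (c i))\<^sup>2" for i
    unfolding wv[symmetric] wc[symmetric]
    using W(1) act_mat_1_column_nonzero[OF assms(8)] act_mat_1_column_nonzero[OF assms(9)]
    by (auto simp: posdef_def)
  have sX: "selberg X W = (\<Sum>i\<in>UNIV. (norm (v i))\<^sup>2 / x $ i)"
    using selberg_diag[OF x(1), of W] Dx(1) by (simp add: wv less_imp_neq[symmetric])
  have sZ: "selberg Z W = (\<Sum>i\<in>UNIV. (norm (c i))\<^sup>2 / z $ i)"
    using selberg_diag[OF z(1), of W] Dz(1) by (simp add: wc less_imp_neq[symmetric])
  have sY: "selberg Y W = (\<Sum>i\<in>UNIV. (norm (v i))\<^sup>2)" "selberg Y W = (\<Sum>i\<in>UNIV. (norm (c i))\<^sup>2)"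
    using selberg_mat_1[OF assms(8), of W] selberg_mat_1[OF assms(9), of W] by (simp_all add: wv wc)

  have "selberg Y X = (\<Sum>i\<in>UNIV. x $ i)" "selberg Y Z = (\<Sum>i\<in>UNIV. z $ i)"
    using selberg_mat_1[OF assms(8), of X] selberg_mat_1[OF assms(9), of Z] x(1) z(1)
    by (simp_all add: inner_column_mult[symmetric] act_def) (simp_all add: diag_def)
  then have L_le: "L \<le> (\<Sum>i\<in>UNIV. x $ i)" "L \<le> (\<Sum>i\<in>UNIV. z $ i)"
    and L_or: "L = (\<Sum>i\<in>UNIV. x $ i) \<or> L = (\<Sum>i\<in>UNIV. z $ i)"
    using assms(5) by auto
  \<comment> \<open>One entry above 1 among positive ones suffices. This gives \<open>1 < L\<close>,
    hence a positive base \<open>\<Lambda>\<close> for the power.\<close>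
  have gt1: "1 < (\<Sum>i\<in>UNIV. y $ i)" if "diag y \<in> chamber_t J t" for y :: "real^'n" and J
  proof -
    note D = chamber_t_diagD[OF that]
    obtain l where "l \<notin> J"
      using D(7) by blast
    then have "1 < y $ l"
      by (rule D(4))
    also have "y $ l \<le> (\<Sum>i\<in>UNIV. y $ i)"
      using D(1) by (intro member_le_sum) (auto intro: less_imp_le)
    finally show ?thesis .
  qed
  have L: "1 < L"
    using L_or gt1[OF x(2)] gt1[OF z(2)] by auto

  define \<Lambda> where "\<Lambda> = (L - 1) / (real CARD('n) - 1)"
  define K where "K = sqrt t * \<Lambda> powr (t / 2)"
  have "0 < \<Lambda>"
    using L assms(1) by (simp add: \<Lambda>_def)
  moreover have "(\<Lambda> powr (t / 2))\<^sup>2 = \<Lambda> powr t"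
    by (simp add: power2_eq_square flip: powr_add)
  ultimately have K: "0 < K" "K\<^sup>2 = t * \<Lambda> powr t"
    using assms(13) by (simp_all add: K_def power_mult_distrib)
  \<comment> \<open>The weights are the squared lengths; the bisector equations are exactly the
    balance required of them.\<close>
  have vK: "K\<^sup>2 * (\<Sum>i\<in>I. (norm (v i))\<^sup>2) < (\<Sum>i\<in>-I. (norm (v i))\<^sup>2)"
    using chamber_t_weights[OF x(2) assms(13,14) pos(1) _ L L_le(1)] W(2) sX sY(1)
    by (simp add: K(2) \<Lambda>_def)
  have cK: "K\<^sup>2 * (\<Sum>i\<in>-I. (norm (c i))\<^sup>2) < (\<Sum>i\<in>I. (norm (c i))\<^sup>2)"
    using chamber_t_weights[OF z(2) assms(13,14) pos(2) _ L L_le(2)] W(3) sZ sY(2)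
    by (simp add: K(2) \<Lambda>_def)

  define e where "e = sqrt (real CARD('n) - 2) * sin \<theta>"
  have \<theta>: "\<theta> = max_column_angle A B"
    using assms(12) by (simp add: A_def B_def)
  note angle = max_column_angle_orthogonal[OF AB, folded \<theta>]
  have e: "0 \<le> e"
    using angle(1,2) assms(1) by (simp add: e_def sin_ge_zero)
  have ce: "0 < cos \<theta> - e"
    using assms(17) by (simp add: e_def)
  have "cos \<theta> \<le> R $ i $ i" for i
    using angle(3)[of i] by (simp add: R_def matrix_matrix_mult_def transpose_def column_def inner_vec_def)
  then have block: "(\<Sum>i\<in>I. \<Sum>j\<in>-I. (R $ j $ i)\<^sup>2) \<le> e\<^sup>2"
    unfolding e_def using R assms(1) e ce by (intro orthogonal_matrix_off_diagonal_block) auto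
  have "(1 + e) / (cos \<theta> - e) \<le> K"
    using assms(18) by (simp add: e_def K_def \<Lambda>_def)
  then have "1 + e \<le> K * (cos \<theta> - e)"
    using ce by (simp add: pos_divide_le_eq)
  also have "\<dots> \<le> K * (1 - e)"
    using K(1) by simp
  finally have Ke: "1 \<le> K * (1 - e)"
    using e by linarith

  show False
  \<comment> \<open>In the cone lemma \<open>x\<close>, \<open>y\<close> are the lengths of
    \<open>v\<close> on \<open>I\<close> and \<open>- I\<close>, and \<open>q\<close>,
    \<open>r\<close> those of \<open>c\<close>.\<close>
  proof (rule cone_transition_impossible[OF _ _ _ K(1) e Ke])
    show "L2_set (\<lambda>i. norm (c i)) I
        \<le> L2_set (\<lambda>j. norm (v j)) I + e * L2_set (\<lambda>j. norm (v j)) (- I)"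
      unfolding c by (rule L2_set_orthogonal_combination_le[OF R e block])
    have sq: "(L2_set (\<lambda>i. norm (u i)) J)\<^sup>2 = (\<Sum>i\<in>J. (norm (u i))\<^sup>2)" for u :: "'n \<Rightarrow> real^'n" and J
      by (simp add: L2_set_def sum_nonneg)
    have split: "(\<Sum>i\<in>I. f i) + (\<Sum>i\<in>-I. f i) = (\<Sum>i\<in>UNIV. f i)" for f :: "'n \<Rightarrow> real"
      by (subst sum.union_disjoint[symmetric]) auto
    show "(L2_set (\<lambda>i. norm (c i)) I)\<^sup>2 + (L2_set (\<lambda>i. norm (c i)) (- I))\<^sup>2
        = (L2_set (\<lambda>j. norm (v j)) I)\<^sup>2 + (L2_set (\<lambda>j. norm (v j)) (- I))\<^sup>2"
      using sY by (simp add: sq split)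
    show "K\<^sup>2 * (L2_set (\<lambda>j. norm (v j)) I)\<^sup>2 < (L2_set (\<lambda>j. norm (v j)) (- I))\<^sup>2"
      using vK by (simp add: sq)
    show "K\<^sup>2 * (L2_set (\<lambda>i. norm (c i)) (- I))\<^sup>2 < (L2_set (\<lambda>i. norm (c i)) I)\<^sup>2"
      using cK by (simp add: sq)
  qed simp_all
qed

end
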